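(* Let $k\ge2$ be an integer and let $$c_k=\left(\sqrt{k^2-1}\right)^{\frac12\left(1-\frac1k\right)}k^{\frac1{2k}}.$$ Then for every integer $n\ge k$, $M_T(n,k)\le c_k^{\,n}$.
   Context: $T(n,k)$ denotes the set of $n\times n$ matrices with entries in $\{0,1\}$ containing exactly $kn$ ones in total. $M_T(n,k)=\max_{A\in T(n,k)}\det(A)$. (The condition $n\ge k$ just ensures $T(n,k)\neq\emptyset$.) *)

theory Defs
  imports Complex_Main "HOL-Library.FuncSet" "Jordan_Normal_Form.Determinant"
begin

definition T :: "nat \<Rightarrow> nat \<Rightarrow> real mat set" where
  "T n k = {A \<in> carrier_mat n n.
     (\<forall>i<n. \<forall>j<n. A $$ (i, j) \<in> {0, 1}) \<and>
     card {(i, j). i < n \<and> j < n \<and> A $$ (i, j) = 1} = k * n}"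

text \<open>The maximum below is over a finite set, which is nonempty for \<open>k \<le> n\<close>;
  see \<open>finite_T\<close> and \<open>T_nonempty\<close>.\<close>

definition M_T :: "nat \<Rightarrow> nat \<Rightarrow> real" where
  "M_T n k = Max (det ` T n k)"

definition c :: "nat \<Rightarrow> real" where
  "c k = (sqrt ((real k)\<^sup>2 - 1)) powr (1 / 2 * (1 - 1 / real k)) * real k powr (1 / (2 * real k))"

lemma finite_T: "finite (T n k)"
proof (rule finite_subset)
  let ?F = "({..<n} \<times> {..<n}) \<rightarrow>\<^sub>E {0, 1 :: real}"
  show "T n k \<subseteq> mat n n ` ?F"
  proof
    fix A assume A: "A \<in> T n k"
    let ?f = "restrict (\<lambda>ij. A $$ ij) ({..<n} \<times> {..<n})"
    have "A = mat n n ?f"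
      using A by (intro eq_matI) (auto simp: T_def)
    moreover have "?f \<in> ?F"
      using A by (auto simp: T_def)
    ultimately show "A \<in> mat n n ` ?F" by blast
  qed
  show "finite (mat n n ` ?F)"
    by (intro finite_imageI finite_PiE) auto
qed

lemma T_nonempty:
  assumes "k \<le> n"
  shows "T n k \<noteq> {}"
proof -
  let ?A = "mat n n (\<lambda>(i, j). if j < k then 1 else 0 :: real)"
  have "{(i, j). i < n \<and> j < n \<and> ?A $$ (i, j) = 1} = {..<n} \<times> {..<k}"
    using assms by (auto split: if_splits)
  then have "?A \<in> T n k"
    unfolding T_def by (auto simp: mult.commute)
  then show ?thesis by blast
qed

end

theory Submission
  imports Defs
begin

text \<open>
  Let a 0-1 matrix \<open>A\<close> have row sums \<open>d i\<close> with total \<open>k * n\<close>.  Hadamard's inequality bounds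
  \<open>(det A)\<^sup>2\<close> by the product of the \<open>d i\<close>, hence by \<open>k ^ n\<close>.  The improvement comes from rows
  that share a column in which both have a one.  If rows \<open>i\<close> and \<open>j\<close> share \<open>m \<ge> 1\<close> such columns,
  subtracting from one row its projection on the other replaces \<open>d i * d j\<close> by
  \<open>d i * d j - m\<^sup>2 \<le> d i * d j - 1\<close> without changing the determinant.  This is done for all
  pairs of a maximal matching of intersecting rows.  The unmatched rows are then pairwise
  disjoint, so they contain at most \<open>n\<close> ones altogether.

  When all row sums are \<open>k\<close>, at most \<open>n / k\<close> rows are unmatched and the bound is
  \<open>(k\<^sup>2 - 1) powr ((n - n / k) / 2) * k powr (n / k)\<close>, which is \<open>c k ^ (2 * n)\<close>.  For unequal row
  sums, two prices absorb the deviation from \<open>k\<close>: a factor \<open>q = row_ratio k\<close> is charged for each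
  one that a row has beyond \<open>k\<close> and credited for each one that it lacks, and a factor
  \<open>r = unmatched_ratio k\<close> is charged for each one in an unmatched row:

  \<^item> \<open>a * b - 1 \<le> (k\<^sup>2 - 1) * q powr (a + b - 2 * k)\<close> (\<open>pair_bound\<close>);
  \<^item> \<open>d \<le> sqrt (k\<^sup>2 - 1) * q powr (d - k) * r ^ d\<close> (\<open>single_bound\<close>).

  In the product over all rows the powers of \<open>q\<close> cancel, because the average row sum is exactly
  \<open>k\<close>, and the powers of \<open>r\<close> contribute at most \<open>r ^ n\<close>.  What remains is
  \<open>(sqrt (k\<^sup>2 - 1) * r) ^ n = c k ^ (2 * n)\<close>.

  These two inequalities use that row sums are integers.  For real row sums, making the unmatched
  rows more numerous and slightly shorter than \<open>k\<close> would push the estimate above the bound; with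
  integers the next shorter length is \<open>k - 1\<close>, and that is already too short to gain.  Both
  inequalities are therefore proved by moving one unit at a time away from the extremal point.
\<close>

section \<open>Hadamard's inequality and row reduction\<close>

lemma gram_diagonal:
  fixes A :: "real mat"
  assumes "A \<in> carrier_mat n m" "i < n"
  shows "(A * A\<^sup>T) $$ (i, i) = (\<Sum>j<m. (A $$ (i, j))\<^sup>2)"
  using assms by (auto simp: scalar_prod_def power2_eq_square lessThan_atLeast0)

text \<open>The matrix is the Householder reflection that maps \<open>r\<close> to a multiple of the first unit vector.
  If \<open>r\<close> already is a nonnegative multiple of it, then \<open>v = 0\<close>, the quotient \<open>2 / V\<close> is \<open>0\<close> by
  convention, and \<open>H\<close> is the identity, as desired.\<close>

lemma orthogonal_clearing_row:
  fixes r :: "nat \<Rightarrow> real"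
  obtains H where "H \<in> carrier_mat n n" "H * H\<^sup>T = 1\<^sub>m n"
    "\<And>j. 0 < j \<Longrightarrow> j < n \<Longrightarrow> (\<Sum>l<n. r l * H $$ (l, j)) = 0"
proof -
  define N where "N = sqrt (\<Sum>l<n. (r l)\<^sup>2)"
  define v where "v l = r l - (if l = 0 then N else 0)" for l
  define V where "V = (\<Sum>l<n. (v l)\<^sup>2)"
  define s where "s = 2 / V"
  define H where "H = mat n n (\<lambda>(i, j). (if i = j then 1 else 0) - s * v i * v j)"
  have ssV: "s * s * V = 2 * s"
    by (simp add: s_def)
  have H: "H \<in> carrier_mat n n" by (simp add: H_def)
  have "(\<Sum>l<n. H $$ (i, l) * H $$ (j, l)) = (if i = j then 1 else 0)" if ij: "i < n" "j < n" for i j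
  proof -
    have "(\<Sum>l<n. H $$ (i, l) * H $$ (j, l)) =
      (\<Sum>l<n. (if l = i then (if i = j then 1 else 0) else 0) - (if l = i then s * v j * v l else 0)
         - (if l = j then s * v i * v l else 0) + s * s * v i * v j * (v l)\<^sup>2)"
      using ij by (intro sum.cong) (auto simp: H_def algebra_simps power2_eq_square)
    also have "\<dots> = (if i = j then 1 else 0) - 2 * s * v i * v j + s * s * V * v i * v j"
      using ij unfolding V_def
      by (simp add: sum.distrib sum_subtractf sum.delta sum_distrib_left sum_distrib_right algebra_simps)
    finally show ?thesis unfolding ssV by simp
  qed
  then have HH: "H * H\<^sup>T = 1\<^sub>m n"
    using H by (intro eq_matI) (auto simp: scalar_prod_def lessThan_atLeast0)
  have "(\<Sum>l<n. r l * H $$ (l, j)) = 0" if j: "0 < j" "j < n" for j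
  proof -
    have N2: "N * N = (\<Sum>l<n. (r l)\<^sup>2)"
      unfolding N_def by (simp add: sum_nonneg)
    have rv: "(\<Sum>l<n. r l * v l) = N * N - N * r 0"
    proof -
      have "(\<Sum>l<n. r l * v l) = (\<Sum>l<n. (r l)\<^sup>2 - (if l = 0 then N * r l else 0))"
        by (intro sum.cong) (auto simp: v_def algebra_simps power2_eq_square)
      then show ?thesis using j N2 by (simp add: sum_subtractf)
    qed
    have "V = (\<Sum>l<n. r l * v l - (if l = 0 then N * v l else 0))"
      unfolding V_def by (intro sum.cong) (auto simp: v_def algebra_simps power2_eq_square)
    also have "\<dots> = 2 * (\<Sum>l<n. r l * v l)"
      using j by (simp add: sum_subtractf rv) (simp add: v_def algebra_simps)
    finally have V: "V = 2 * (\<Sum>l<n. r l * v l)" .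
    have "(\<Sum>l<n. r l * H $$ (l, j)) = (\<Sum>l<n. (if l = j then r l else 0) - s * v j * (r l * v l))"
      using j by (intro sum.cong) (auto simp: H_def algebra_simps)
    also have "\<dots> = r j - s * v j * (\<Sum>l<n. r l * v l)"
      using j by (simp add: sum_subtractf sum_distrib_left)
    also have "\<dots> = r j - s * V / 2 * v j" using V by simp
    also have "\<dots> = 0"
    proof (cases "V = 0")
      case True
      then have "v j = 0" using j unfolding V_def by (simp add: sum_nonneg_eq_0_iff)
      then show ?thesis using j by (simp add: v_def)
    next
      case False
      then show ?thesis using j by (simp add: s_def v_def)
    qed
    finally show ?thesis .
  qed
  with H HH show thesis using that by blast
qed

text \<open>Multiplying by an orthogonal matrix on the right keeps the row norms and the square of the
  determinant.  Once the first row is concentrated in its first entry, the determinant is that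
  entry times a minor, and deleting a column only shortens the other rows.\<close>

lemma hadamard_inequality:
  fixes A :: "real mat"
  assumes "A \<in> carrier_mat n n"
  shows "(det A)\<^sup>2 \<le> (\<Prod>i<n. \<Sum>j<n. (A $$ (i, j))\<^sup>2)"
  using assms
proof (induction n arbitrary: A)
  case 0
  then show ?case by simp
next
  case (Suc n)
  note A = Suc.prems
  obtain H where H: "H \<in> carrier_mat (Suc n) (Suc n)" "H * H\<^sup>T = 1\<^sub>m (Suc n)"
    and z: "\<And>j. 0 < j \<Longrightarrow> j < Suc n \<Longrightarrow> (\<Sum>l<Suc n. A $$ (0, l) * H $$ (l, j)) = 0"
    using orthogonal_clearing_row[of "Suc n" "\<lambda>l. A $$ (0, l)"] by blast
  define B where "B = A * H"
  have B: "B \<in> carrier_mat (Suc n) (Suc n)" using A H by (simp add: B_def)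
  have "det H * det H = 1"
    using H by (metis det_mult det_one det_transpose transpose_carrier_mat)
  then have detB: "(det B)\<^sup>2 = (det A)\<^sup>2"
    using det_mult[OF A H(1)] by (simp add: B_def power_mult_distrib power2_eq_square)
  have "B * B\<^sup>T = A * A\<^sup>T"
  proof -
    have "B * B\<^sup>T = (A * H) * (H\<^sup>T * A\<^sup>T)"
      unfolding B_def using A H by (simp add: transpose_mult)
    also have "\<dots> = A * (H * (H\<^sup>T * A\<^sup>T))"
      using A H by (intro assoc_mult_mat[where n\<^sub>2="Suc n" and n\<^sub>3="Suc n" and n\<^sub>4="Suc n"]) auto
    also have "H * (H\<^sup>T * A\<^sup>T) = (H * H\<^sup>T) * A\<^sup>T"
      using A H by (intro assoc_mult_mat[symmetric, where n\<^sub>2="Suc n" and n\<^sub>3="Suc n" and n\<^sub>4="Suc n"]) auto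
    finally show ?thesis using A H by simp
  qed
  then have norms: "(\<Sum>j<Suc n. (B $$ (i, j))\<^sup>2) = (\<Sum>j<Suc n. (A $$ (i, j))\<^sup>2)" if "i < Suc n" for i
    using gram_diagonal[OF A that] gram_diagonal[OF B that] by simp
  have B0: "B $$ (0, j) = 0" if "0 < j" "j < Suc n" for j
    using z[OF that] A H that by (simp add: B_def scalar_prod_def lessThan_atLeast0)
  define C where "C = mat_delete B 0 0"
  have C: "C \<in> carrier_mat n n" using B by (auto simp: C_def mat_delete_def)
  have Cij: "C $$ (i, j) = B $$ (Suc i, Suc j)" if "i < n" "j < n" for i j
    using that B by (simp add: C_def mat_delete_def)
  have "det B = (\<Sum>j<Suc n. B $$ (0, j) * cofactor B 0 j)"
    by (rule laplace_expansion_row[OF B]) simp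
  also have "\<dots> = (\<Sum>j\<in>{0}. B $$ (0, j) * cofactor B 0 j)"
    using B0 by (intro sum.mono_neutral_right) auto
  finally have "det B = B $$ (0, 0) * det C" by (simp add: cofactor_def C_def)
  then have "(det A)\<^sup>2 = (B $$ (0, 0))\<^sup>2 * (det C)\<^sup>2"
    using detB by (simp add: power_mult_distrib)
  also have "\<dots> \<le> (\<Sum>j<Suc n. (B $$ (0, j))\<^sup>2) * (\<Prod>i<n. \<Sum>j<Suc n. (B $$ (Suc i, j))\<^sup>2)"
  proof (rule mult_mono)
    show "(B $$ (0, 0))\<^sup>2 \<le> (\<Sum>j<Suc n. (B $$ (0, j))\<^sup>2)"
      by (rule member_le_sum) auto
    have "(det C)\<^sup>2 \<le> (\<Prod>i<n. \<Sum>j<n. (C $$ (i, j))\<^sup>2)" by (rule Suc.IH[OF C])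
    also have "\<dots> \<le> (\<Prod>i<n. \<Sum>j<Suc n. (B $$ (Suc i, j))\<^sup>2)"
      by (intro prod_mono) (auto simp: Cij sum.lessThan_Suc_shift sum_nonneg simp del: sum.lessThan_Suc)
    finally show "(det C)\<^sup>2 \<le> (\<Prod>i<n. \<Sum>j<Suc n. (B $$ (Suc i, j))\<^sup>2)" .
  qed (auto intro: sum_nonneg prod_nonneg simp del: sum.lessThan_Suc)
  also have "\<dots> = (\<Prod>i<Suc n. \<Sum>j<Suc n. (B $$ (i, j))\<^sup>2)"
    by (simp add: prod.lessThan_Suc_shift del: prod.lessThan_Suc sum.lessThan_Suc)
  also have "\<dots> = (\<Prod>i<Suc n. \<Sum>j<Suc n. (A $$ (i, j))\<^sup>2)"
    by (intro prod.cong refl norms) simp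
  finally show ?case .
qed

text \<open>Subtracting from each row a combination of the \<^emph>\<open>original\<close> rows above it is multiplication by a
  unit lower triangular matrix.  Stating the row operations all at once makes it unnecessary to
  order them.\<close>

lemma det_sq_le_reduced_rows:
  fixes A :: "real mat" and w :: "nat \<Rightarrow> nat \<Rightarrow> real"
  assumes A: "A \<in> carrier_mat n n"
  shows "(det A)\<^sup>2 \<le> (\<Prod>i<n. \<Sum>j<n. (A $$ (i, j) - (\<Sum>l<i. w i l * A $$ (l, j)))\<^sup>2)"
proof -
  define L where "L = mat n n (\<lambda>(i, l). if i = l then 1 else if l < i then - w i l else 0)"
  have L: "L \<in> carrier_mat n n" by (simp add: L_def)
  have "det L = prod_list (diag_mat L)"
    by (rule det_lower_triangular[OF _ L]) (simp add: L_def)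
  also have "diag_mat L = map (\<lambda>i. 1) [0..<n]"
    by (auto simp: diag_mat_def L_def)
  finally have "det L = 1" by (simp add: map_replicate_const)
  then have "det (L * A) = det A" using det_mult[OF L A] by simp
  moreover have "(L * A) $$ (i, j) = A $$ (i, j) - (\<Sum>l<i. w i l * A $$ (l, j))" if ij: "i < n" "j < n" for i j
  proof -
    have "(L * A) $$ (i, j) = (\<Sum>l<n. L $$ (i, l) * A $$ (l, j))"
      using A L ij by (simp add: scalar_prod_def lessThan_atLeast0)
    also have "\<dots> = (\<Sum>l<n. (if l = i then A $$ (l, j) else 0) - (if l \<in> {..<i} then w i l * A $$ (l, j) else 0))"
      using ij by (intro sum.cong) (auto simp: L_def)
    also have "\<dots> = A $$ (i, j) - (\<Sum>l<n. if l \<in> {..<i} then w i l * A $$ (l, j) else 0)"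
      using ij by (simp add: sum_subtractf)
    also have "(\<Sum>l<n. if l \<in> {..<i} then w i l * A $$ (l, j) else 0) = (\<Sum>l<i. w i l * A $$ (l, j))"
      using ij by (subst sum.inter_restrict[symmetric]) (auto intro: sum.cong)
    finally show ?thesis .
  qed
  ultimately show ?thesis
    using hadamard_inequality[OF mult_carrier_mat[OF L A]] by simp
qed

section \<open>Maximal matchings\<close>

text \<open>Pairs are removed greedily until none is left.  The matching enters the determinant bound only
  through the factorisation of products over \<open>V\<close>, so this factorisation for all \<open>g\<close> is what is
  recorded; the conditions on \<open>fst ` M\<close> and \<open>snd ` M\<close> ensure that when every second component
  is reduced by its partner, no row is reduced twice, no reduced row serves as a partner,
  and no unmatched row changes.
  The pairs are ordered so that each reduction uses an earlier row.\<close>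

lemma maximal_matching:
  fixes R :: "'a :: linorder \<Rightarrow> 'a \<Rightarrow> bool"
  assumes "finite V"
  obtains M U where "finite M" "M \<subseteq> {(i, j). i \<in> V \<and> j \<in> V \<and> i < j \<and> R i j}"
    "inj_on snd M" "fst ` M \<inter> snd ` M = {}" "U \<inter> snd ` M = {}" "U \<subseteq> V"
    "\<And>i j. i \<in> U \<Longrightarrow> j \<in> U \<Longrightarrow> i < j \<Longrightarrow> \<not> R i j"
    "\<And>g :: 'a \<Rightarrow> 'b :: comm_monoid_mult. prod g V = (\<Prod>(i, j)\<in>M. g i * g j) * prod g U"
proof -
  define good where "good V M U \<longleftrightarrow> finite M \<and> M \<subseteq> {(i, j). i \<in> V \<and> j \<in> V \<and> i < j \<and> R i j} \<and>
    inj_on snd M \<and> fst ` M \<inter> snd ` M = {} \<and> U \<inter> snd ` M = {} \<and> U \<subseteq> V \<and>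
    (\<forall>i\<in>U. \<forall>j\<in>U. i < j \<longrightarrow> \<not> R i j) \<and>
    (\<forall>g :: 'a \<Rightarrow> 'b. prod g V = (\<Prod>(i, j)\<in>M. g i * g j) * prod g U)" for V M U
  have "\<exists>M U. good V M U"
    using assms
  proof (induction V rule: finite_psubset_induct)
    case (psubset V)
    show ?case
    proof (cases "\<exists>i\<in>V. \<exists>j\<in>V. i < j \<and> R i j")
      case False
      then have "good V {} V" by (auto simp: good_def)
      then show ?thesis by blast
    next
      case True
      then obtain a b where ab: "a \<in> V" "b \<in> V" "a < b" "R a b" by blast
      let ?W = "V - {a, b}"
      obtain M U where MU: "good ?W M U" using psubset.IH[of ?W] ab by blast
      have fM: "finite M" and sub: "M \<subseteq> {(i, j). i \<in> ?W \<and> j \<in> ?W \<and> i < j \<and> R i j}"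
        and eq: "\<And>g :: 'a \<Rightarrow> 'b. prod g ?W = (\<Prod>(i, j)\<in>M. g i * g j) * prod g U"
        using MU by (auto simp: good_def)
      have new: "(a, b) \<notin> M" "a \<notin> fst ` M" "a \<notin> snd ` M" "b \<notin> fst ` M" "b \<notin> snd ` M"
        using sub by auto
      have "prod g V = (\<Prod>(i, j)\<in>insert (a, b) M. g i * g j) * prod g U" for g :: "'a \<Rightarrow> 'b"
      proof -
        have "prod g V = prod g {a, b} * prod g ?W"
          using psubset.hyps ab by (intro prod.subset_diff[THEN trans, OF _ _ mult.commute]) auto
        then show ?thesis using ab fM new eq[of g] by (simp add: mult.assoc)
      qed
      then have "good V (insert (a, b) M) U"
        using MU ab new unfolding good_def by auto
      then show ?thesis by blast
    qed
  qed
  then obtain M U where "good V M U" by blast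
  then show thesis by (intro that[of M U]) (simp_all add: good_def)
qed

section \<open>Pricing the row sums\<close>

text \<open>A discrete substitute for a tangent line to a log-concave function: if the ratios of consecutive
  values are at most \<open>q\<close> to the right of \<open>N\<close> and at least \<open>q\<close> to the left, then the geometric
  progression of ratio \<open>q\<close> through \<open>(N, f N)\<close> dominates \<open>f\<close>.\<close>

lemma powr_step_bound:
  fixes f :: "nat \<Rightarrow> real"
  assumes "q > 0" and up: "\<And>s. s \<ge> N \<Longrightarrow> f (Suc s) \<le> q * f s"
    and down: "\<And>s. m \<le> s \<Longrightarrow> s < N \<Longrightarrow> q * f s \<le> f (Suc s)"
    and "m \<le> s"
  shows "f s \<le> f N * q powr (real s - real N)"
proof (cases "N \<le> s")
  case True
  then show ?thesis
  proof (induction s rule: dec_induct)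
    case (step s)
    have "f (Suc s) \<le> q * f s" by (rule up) fact
    also have "\<dots> \<le> q * (f N * q powr (real s - real N))"
      using step.IH assms(1) by simp
    also have "\<dots> = f N * q powr (real (Suc s) - real N)"
      using assms(1) by (simp add: powr_add powr_diff field_simps)
    finally show ?case .
  qed (use assms in simp)
next
  case False
  then have "s \<le> N" by simp
  then show ?thesis using \<open>m \<le> s\<close>
  proof (induction s rule: inc_induct)
    case (step s)
    have "q * f s \<le> f (Suc s)" using step by (intro down) auto
    also have "\<dots> \<le> f N * q powr (real (Suc s) - real N)" using step by simp
    also have "\<dots> = q * (f N * q powr (real s - real N))"
      using assms(1) by (simp add: powr_add powr_diff field_simps)
    finally show ?case using assms(1) by simp
  qed (use assms in simp)
qed

text \<open>The growth of the largest \<open>a * b - 1\<close> when the sum \<open>a + b\<close> goes from \<open>2 * k\<close> to \<open>2 * k + 1\<close>, that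
  is \<open>(k * (k + 1) - 1) / (k\<^sup>2 - 1)\<close>.  It is the smallest price per one that \<open>pair_bound\<close> allows.\<close>

definition row_ratio :: "nat \<Rightarrow> real" where "row_ratio k = 1 + real k / ((real k)\<^sup>2 - 1)"

text \<open>Chosen such that \<open>single_bound\<close> is an equality at \<open>d = k\<close>.\<close>

definition unmatched_ratio :: "nat \<Rightarrow> real" where
  "unmatched_ratio k = (real k / sqrt ((real k)\<^sup>2 - 1)) powr (1 / real k)"

lemma sq_minus_1_pos: "k \<ge> 2 \<Longrightarrow> (real k)\<^sup>2 - 1 > 0"
  by (simp add: one_less_power)

lemma row_ratio_pos: "k \<ge> 2 \<Longrightarrow> row_ratio k > 0"
  using sq_minus_1_pos[of k] unfolding row_ratio_def by (intro add_pos_nonneg) auto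

lemma unmatched_ratio_ge_1: assumes "k \<ge> 2" shows "unmatched_ratio k \<ge> 1"
proof -
  have "sqrt ((real k)\<^sup>2 - 1) \<le> sqrt ((real k)\<^sup>2)" by (intro real_sqrt_le_mono) simp
  then have "1 \<le> real k / sqrt ((real k)\<^sup>2 - 1)"
    using sq_minus_1_pos[OF assms] by (simp add: field_simps)
  then show ?thesis unfolding unmatched_ratio_def using assms by (intro ge_one_powr_ge_zero) auto
qed

text \<open>The largest \<open>a * b - 1\<close> for naturals with \<open>a + b = s\<close>: the factors are as equal as possible.\<close>

definition balanced_pair :: "nat \<Rightarrow> real" where
  "balanced_pair s = real (s div 2) * real ((s + 1) div 2) - 1"

lemma mult_le_balanced_pair:
  fixes a b :: nat
  shows "real a * real b - 1 \<le> balanced_pair (a + b)"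
proof -
  let ?x = "(a + b) div 2" and ?y = "(a + b + 1) div 2"
  have "n div 2 + (n + 1) div 2 = n" for n :: nat
    by (cases "even n") (auto elim!: evenE oddE)
  then have s: "?x + ?y = a + b" .
  have lo: "min a b \<le> ?x" by linarith
  have hi: "?x \<le> max a b" by linarith
  have y: "real ?y = real a + real b - real ?x" using s by linarith
  have "0 \<le> (real ?x - real (min a b)) * (real (max a b) - real ?x)"
    using lo hi by (intro mult_nonneg_nonneg) auto
  also have "\<dots> = (real ?x - real a) * (real b - real ?x)"
    by (cases "a \<le> b") (auto simp: min_def max_def algebra_simps)
  also have "\<dots> = real ?x * real ?y - real a * real b" unfolding y by (simp add: algebra_simps)
  finally show ?thesis by (simp add: balanced_pair_def)
qed

lemma balanced_pair_even: "balanced_pair (2 * m) = (real m)\<^sup>2 - 1"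
  by (simp add: balanced_pair_def power2_eq_square)

lemma balanced_pair_odd: "balanced_pair (Suc (2 * m)) = (real m)\<^sup>2 + real m - 1"
  by (simp add: balanced_pair_def power2_eq_square algebra_simps)

text \<open>For a fixed sum the product is largest when the summands are balanced, so this is a statement
  about \<open>balanced_pair\<close>, whose step ratios are compared with \<open>row_ratio k\<close> on either side of
  \<open>2 * k\<close>.\<close>

lemma pair_bound:
  assumes k: "k \<ge> 2"
  shows "real a * real b - 1 \<le> ((real k)\<^sup>2 - 1) * row_ratio k powr (real a + real b - 2 * real k)"
proof -
  define K where "K = (real k)\<^sup>2 - 1"
  have K: "K > 0" using sq_minus_1_pos[OF k] by (simp add: K_def)
  have step: "row_ratio k * x \<le> y \<longleftrightarrow> real k * x \<le> K * (y - x)"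
    "y \<le> row_ratio k * x \<longleftrightarrow> K * (y - x) \<le> real k * x" for x y
    using K by (auto simp: row_ratio_def K_def[symmetric] field_simps)
  have "balanced_pair (a + b) \<le> balanced_pair (2 * k) * row_ratio k powr (real (a + b) - real (2 * k))"
  proof (rule powr_step_bound[where m = 0])
    fix s assume s: "s \<ge> 2 * k"
    show "balanced_pair (Suc s) \<le> row_ratio k * balanced_pair s"
    proof (cases "even s")
      case True
      then obtain m where m: "s = 2 * m" by blast
      with s have "m \<ge> k" by simp
      then obtain i where i: "m = k + i" using le_Suc_ex by blast
      show ?thesis unfolding step unfolding m balanced_pair_even balanced_pair_odd K_def i
        by (simp add: algebra_simps power2_eq_square)
    next
      case False
      then obtain m where m: "s = Suc (2 * m)" by (auto elim: oddE)
      with s have "m \<ge> k" by simp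
      then obtain i where i: "m = k + i" using le_Suc_ex by blast
      have m': "Suc s = 2 * (m + 1)" using m by simp
      show ?thesis unfolding step unfolding m' balanced_pair_even unfolding m balanced_pair_odd K_def i
        by (simp add: algebra_simps power2_eq_square)
    qed
  next
    fix s assume s: "s < 2 * k"
    show "row_ratio k * balanced_pair s \<le> balanced_pair (Suc s)"
    proof (cases "even s")
      case True
      then obtain m where m: "s = 2 * m" by blast
      with s have "m \<le> k" by simp
      then obtain i where i: "k = m + i" using le_Suc_ex by blast
      show ?thesis unfolding step unfolding m balanced_pair_even balanced_pair_odd K_def i
        by (simp add: algebra_simps power2_eq_square)
    next
      case False
      then obtain m where m: "s = Suc (2 * m)" by (auto elim: oddE)
      with s have "m + 1 \<le> k" by simp
      then obtain i where i: "k = m + 1 + i" using le_Suc_ex by blast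
      have m': "Suc s = 2 * (m + 1)" using m by simp
      show ?thesis unfolding step unfolding m' balanced_pair_even unfolding m balanced_pair_odd K_def i
        by (simp add: algebra_simps power2_eq_square)
    qed
  qed (use assms row_ratio_pos in auto)
  with mult_le_balanced_pair[of a b] show ?thesis by (simp add: balanced_pair_even)
qed

text \<open>This is the inequality that rules out a gain from unmatched rows of length \<open>k - 1\<close>.  The quotient
  of \<open>k / (k - 1)\<close> by \<open>row_ratio k\<close> is \<open>t = 1 + 1 / (k\<^sup>2 + k - 1)\<close>, so the claim is
  \<open>k / sqrt (k\<^sup>2 - 1) \<le> t ^ k\<close>; after squaring, the left side is \<open>1 + 1 / (k\<^sup>2 - 1)\<close> and Bernoulli's
  inequality for the exponent \<open>2 * k\<close> suffices.\<close>

lemma ratio_product_le: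
  assumes k: "k \<ge> 2"
  shows "row_ratio k * unmatched_ratio k \<le> real k / (real k - 1)"
proof -
  define x where "x = real k"
  have x: "x \<ge> 2" using k by (simp add: x_def)
  have K: "x\<^sup>2 - 1 > 0" using sq_minus_1_pos[OF k] by (simp add: x_def)
  define D where "D = x\<^sup>2 + x - 1"
  have D: "D > 0" using K x unfolding D_def by linarith
  define t where "t = 1 + 1 / D"
  have t: "t \<ge> 1" using D by (simp add: t_def)
  have split: "x / (x - 1) = row_ratio k * t"
  proof -
    have "row_ratio k = D / ((x - 1) * (x + 1))"
      using K unfolding row_ratio_def x_def[symmetric] D_def by (simp add: field_simps power2_eq_square)
    moreover have "t = x * (x + 1) / D" using D by (simp add: t_def D_def field_simps power2_eq_square)
    ultimately show ?thesis using x D by simp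
  qed
  have "(x / sqrt (x\<^sup>2 - 1))\<^sup>2 = 1 + 1 / (x\<^sup>2 - 1)"
    using K by (simp add: power_divide field_simps)
  also have "\<dots> \<le> 1 + real (2 * k) * (1 / D)"
  proof -
    have "D \<le> 2 * x * (x\<^sup>2 - 1)"
    proof -
      have "D \<le> 4 * (x\<^sup>2 - 1)"
      proof -
        have "2 * x \<le> x * x" using x by simp
        then show ?thesis using x unfolding D_def power2_eq_square by argo
      qed
      also have "\<dots> \<le> 2 * x * (x\<^sup>2 - 1)" using x K by (intro mult_right_mono) auto
      finally show ?thesis .
    qed
    then show ?thesis using K D by (simp add: x_def[symmetric] field_simps)
  qed
  also have "\<dots> \<le> (1 + 1 / D) ^ (2 * k)"
    by (rule Bernoulli_inequality) (use D in \<open>simp add: order_trans[of _ 0]\<close>)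
  also have "\<dots> = (t ^ k)\<^sup>2" by (simp add: t_def power_mult power2_eq_square power_add mult_2)
  finally have "x / sqrt (x\<^sup>2 - 1) \<le> t ^ k"
    using t by (intro power2_le_imp_le[of "x / sqrt (x\<^sup>2 - 1)"]) auto
  then have "unmatched_ratio k \<le> (t ^ k) powr (1 / x)"
    unfolding unmatched_ratio_def x_def[symmetric] using x K by (intro powr_mono2) auto
  also have "\<dots> = t"
    using t x k by (simp add: powr_realpow[symmetric] powr_powr x_def)
  finally show ?thesis unfolding x_def[symmetric] split
    using row_ratio_pos[OF k] by simp
qed

text \<open>At \<open>d = k\<close> both sides are \<open>k\<close>.  The right side is geometric in \<open>d\<close> with ratio
  \<open>p = row_ratio k * unmatched_ratio k\<close>, and \<open>p\<close> lies between \<open>(k + 1) / k\<close> and \<open>k / (k - 1)\<close>, the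
  step ratios of \<open>d\<close> just above and just below \<open>k\<close>.\<close>

lemma single_bound:
  assumes k: "k \<ge> 2"
  shows "real d \<le> sqrt ((real k)\<^sup>2 - 1) * row_ratio k powr (real d - real k) * unmatched_ratio k ^ d"
proof (cases "d = 0")
  case True
  then show ?thesis using sq_minus_1_pos[OF k] by simp
next
  case False
  define p where "p = row_ratio k * unmatched_ratio k"
  have rho: "unmatched_ratio k \<ge> 1" by (rule unmatched_ratio_ge_1[OF k])
  have p: "p > 0" using row_ratio_pos[OF k] rho by (simp add: p_def)
  have "1 + 1 / real k \<le> row_ratio k"
    using sq_minus_1_pos[OF k] k unfolding row_ratio_def by (simp add: field_simps power2_eq_square)
  also have "\<dots> \<le> p" unfolding p_def using rho row_ratio_pos[OF k] by simp
  finally have up: "1 + 1 / real k \<le> p" .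
  have "real d \<le> real k * p powr (real d - real k)"
  proof (rule powr_step_bound[OF p, where m = 1])
    fix s assume s: "s \<ge> k"
    have "1 + 1 / real s \<le> 1 + 1 / real k" using s k by (simp add: field_simps)
    with up have "1 + 1 / real s \<le> p" by linarith
    then show "real (Suc s) \<le> p * real s" using s k by (simp add: field_simps)
  next
    fix s assume s: "1 \<le> s" "s < k"
    have "p \<le> real k / (real k - 1)" unfolding p_def by (rule ratio_product_le[OF k])
    also have "\<dots> \<le> real (Suc s) / real s" using s by (simp add: field_simps)
    finally show "p * real s \<le> real (Suc s)" using s by (simp add: field_simps)
  qed (use False in simp)
  also have "\<dots> = real k / unmatched_ratio k ^ k * row_ratio k powr (real d - real k) * unmatched_ratio k ^ d"
    using row_ratio_pos[OF k] rho
    by (simp add: p_def powr_mult powr_diff[of "unmatched_ratio k"] powr_realpow)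
  also have "unmatched_ratio k ^ k = real k / sqrt ((real k)\<^sup>2 - 1)"
    using sq_minus_1_pos[OF k] k rho unfolding unmatched_ratio_def
    by (subst powr_realpow[symmetric]) (auto simp: powr_powr)
  also have "real k / (real k / sqrt ((real k)\<^sup>2 - 1)) = sqrt ((real k)\<^sup>2 - 1)"
    using k by simp
  finally show ?thesis .
qed

lemma c_squared:
  assumes k: "k \<ge> 2"
  shows "(c k)\<^sup>2 = sqrt ((real k)\<^sup>2 - 1) * unmatched_ratio k"
proof -
  define S where "S = sqrt ((real k)\<^sup>2 - 1)"
  have S: "S > 0" using sq_minus_1_pos[OF k] by (simp add: S_def)
  have half: "(2 - 2 / real k) / 2 = 1 - 1 / real k" by (simp add: field_simps)
  have "(c k)\<^sup>2 = S powr (1 - 1 / real k) * real k powr (1 / real k)"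
    using S k unfolding c_def S_def[symmetric]
    by (simp add: power_mult_distrib powr_powr half flip: powr_power powr_realpow)
  then show ?thesis using S k unfolding unmatched_ratio_def S_def[symmetric]
    by (simp add: powr_diff powr_divide)
qed

section \<open>The determinant bound\<close>

lemma det_sq_le_c_of_T:
  assumes k: "k \<ge> 2" and AT: "A \<in> T n k"
  shows "(det A)\<^sup>2 \<le> (c k ^ n)\<^sup>2"
proof -
  have A: "A \<in> carrier_mat n n"
    and A01: "\<And>i j. i < n \<Longrightarrow> j < n \<Longrightarrow> A $$ (i, j) = 0 \<or> A $$ (i, j) = 1"
    and ones: "card {(i, j). i < n \<and> j < n \<and> A $$ (i, j) = 1} = k * n"
    using AT by (auto simp: T_def)
  \<comment> \<open>Rows are identified with their supports, so inner products become intersection sizes.\<close>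
  define D where "D i = {j. j < n \<and> A $$ (i, j) = 1}" for i
  define d where "d i = card (D i)" for i
  have finD: "finite (D i)" for i by (simp add: D_def)
  have inner: "(\<Sum>j<n. A $$ (i, j) * A $$ (l, j)) = real (card (D i \<inter> D l))" if "i < n" "l < n" for i l
  proof -
    have "(\<Sum>j<n. A $$ (i, j) * A $$ (l, j)) = (\<Sum>j<n. if j \<in> D i \<inter> D l then 1 else 0)"
      using A01 that by (intro sum.cong) (auto simp: D_def)
    also have "\<dots> = (\<Sum>j\<in>{..<n} \<inter> (D i \<inter> D l). 1)"
      by (rule sum.inter_restrict[symmetric]) simp
    also have "{..<n} \<inter> (D i \<inter> D l) = D i \<inter> D l" by (auto simp: D_def)
    finally show ?thesis by simp
  qed
  have norm: "(\<Sum>j<n. (A $$ (i, j))\<^sup>2) = real (d i)" if "i < n" for i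
    using inner[OF that that] by (simp add: power2_eq_square d_def)
  have "{(i, j). i < n \<and> j < n \<and> A $$ (i, j) = 1} = (SIGMA i:{..<n}. D i)"
    by (auto simp: D_def)
  then have sum_d: "(\<Sum>i<n. d i) = k * n"
    using ones finD by (simp add: card_SigmaI d_def)

  obtain M U where M: "finite M" "M \<subseteq> {(i, j). i \<in> {..<n} \<and> j \<in> {..<n} \<and> i < j \<and> D i \<inter> D j \<noteq> {}}"
    and inj: "inj_on snd M" and disj: "fst ` M \<inter> snd ` M = {}" "U \<inter> snd ` M = {}"
    and U: "U \<subseteq> {..<n}" "\<And>i j. i \<in> U \<Longrightarrow> j \<in> U \<Longrightarrow> i < j \<Longrightarrow> \<not> D i \<inter> D j \<noteq> {}"
    and split: "\<And>g :: nat \<Rightarrow> real. prod g {..<n} = (\<Prod>(i, j)\<in>M. g i * g j) * prod g U"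
    using maximal_matching[of "{..<n}" "\<lambda>i j. D i \<inter> D j \<noteq> {}"] by blast
  have finU: "finite U" using U(1) by (rule finite_subset) simp

  \<comment> \<open>The coefficients of the projection of row \<open>i\<close> on its partner; \<open>b\<close> are the squared norms after
    the reduction.\<close>
  define w where "w i l = (if (l, i) \<in> M then real (card (D i \<inter> D l)) / d l else 0)" for i l
  define b where "b i = (\<Sum>j<n. (A $$ (i, j) - (\<Sum>l<i. w i l * A $$ (l, j)))\<^sup>2)" for i
  have b_nonneg: "b i \<ge> 0" for i by (simp add: b_def sum_nonneg)
  have b_unchanged: "b i = d i" if "i < n" "i \<notin> snd ` M" for i
  proof -
    have "w i l = 0" for l using that by (force simp: w_def)
    then show ?thesis using norm[OF that(1)] by (simp add: b_def)
  qed

  define S where "S = sqrt ((real k)\<^sup>2 - 1)"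
  \<comment> \<open>The share of row \<open>i\<close> in the bound, apart from the surcharge for unmatched rows.\<close>
  define g where "g i = S * row_ratio k powr (real (d i) - real k)" for i
  have S: "S > 0" "S * S = (real k)\<^sup>2 - 1"
    using sq_minus_1_pos[OF k] by (simp_all add: S_def)
  have g_nonneg: "g i \<ge> 0" for i using S by (simp add: g_def)
  have pair: "b l * b i \<le> g l * g i" if "(l, i) \<in> M" for l i
  proof -
    define m where "m = card (D i \<inter> D l)"
    define t where "t = real m / d l"
    have li: "l < i" "i < n" "l < n" "D l \<inter> D i \<noteq> {}" using that M(2) by auto
    have m: "m \<ge> 1" using li finD by (auto simp: m_def Suc_le_eq card_gt_0_iff)
    have d: "d l \<ge> 1" "d i \<ge> 1" using li finD by (auto simp: d_def Suc_le_eq card_gt_0_iff)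
    have "l \<notin> snd ` M" using disj that by force
    then have bl: "b l = d l" using li by (intro b_unchanged)
    have w: "w i l' = (if l' = l then t else 0)" for l'
    proof (cases "l' = l")
      case False
      then have "(l', i) \<notin> M" using that inj_onD[OF inj, of "(l', i)" "(l, i)"] by auto
      with False show ?thesis by (simp add: w_def)
    qed (use that in \<open>simp add: w_def t_def m_def\<close>)
    have "b i = (\<Sum>j<n. (A $$ (i, j) - t * A $$ (l, j))\<^sup>2)"
      using li unfolding b_def w by (simp add: if_distrib[of "\<lambda>x. x * _"] cong: if_cong)
    also have "\<dots> = (\<Sum>j<n. (A $$ (i, j))\<^sup>2 - 2 * t * (A $$ (i, j) * A $$ (l, j)) + t\<^sup>2 * (A $$ (l, j))\<^sup>2)"
      by (intro sum.cong) (auto simp: power2_eq_square algebra_simps)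
    also have "\<dots> = d i - 2 * t * m + t\<^sup>2 * d l"
      using li by (simp add: sum.distrib sum_subtractf inner norm m_def flip: sum_distrib_left)
    also have "\<dots> = d i - (real m)\<^sup>2 / d l"
      using d by (simp add: t_def power2_eq_square field_simps)
    finally have "b l * b i = real (d l) * real (d i) - (real m)\<^sup>2"
      using d by (simp add: bl field_simps)
    also have "\<dots> \<le> real (d l) * real (d i) - 1" using m by simp
    also have "\<dots> \<le> ((real k)\<^sup>2 - 1) * row_ratio k powr (real (d l) + real (d i) - 2 * real k)"
      by (rule pair_bound[OF k])
    also have "real (d l) + real (d i) - 2 * real k = (real (d l) - real k) + (real (d i) - real k)"
      by simp
    also have "((real k)\<^sup>2 - 1) * row_ratio k powr \<dots> = g l * g i"
      unfolding powr_add g_def S(2)[symmetric] by (simp add: mult_ac)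
    finally show ?thesis .
  qed
  have single: "b i \<le> g i * unmatched_ratio k ^ d i" if "i \<in> U" for i
  proof -
    have "i < n" "i \<notin> snd ` M" using that U disj by auto
    then show ?thesis using single_bound[OF k, of "d i"] by (simp add: b_unchanged g_def S_def)
  qed

  \<comment> \<open>Maximality of the matching makes the supports of the unmatched rows disjoint.\<close>
  have "(\<Sum>i\<in>U. d i) = card (\<Union>i\<in>U. D i)"
    unfolding d_def using U(2) finU finD
    by (intro card_UN_disjoint[symmetric]) (auto, metis disjoint_iff linorder_neqE_nat)
  also have "\<dots> \<le> card {..<n}" by (intro card_mono) (auto simp: D_def)
  finally have sum_U: "(\<Sum>i\<in>U. d i) \<le> n" by simp
  have prod_g: "prod g {..<n} = S ^ n"
  proof -
    have "prod g {..<n} = S ^ n * row_ratio k powr (\<Sum>i<n. real (d i) - real k)"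
      using row_ratio_pos[OF k] by (simp add: g_def prod.distrib powr_sum)
    also have "(\<Sum>i<n. real (d i) - real k) = 0"
      using arg_cong[OF sum_d, of real] by (simp add: sum_subtractf)
    finally show ?thesis using row_ratio_pos[OF k] by simp
  qed
  have "(det A)\<^sup>2 \<le> prod b {..<n}"
    unfolding b_def by (rule det_sq_le_reduced_rows[OF A])
  also have "\<dots> = (\<Prod>(i, j)\<in>M. b i * b j) * prod b U" by (rule split)
  also have "\<dots> \<le> (\<Prod>(i, j)\<in>M. g i * g j) * (\<Prod>i\<in>U. g i * unmatched_ratio k ^ d i)"
    using pair single b_nonneg g_nonneg
    by (intro mult_mono prod_mono prod_nonneg) auto
  also have "\<dots> = S ^ n * unmatched_ratio k ^ (\<Sum>i\<in>U. d i)"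
    using split[of g] by (simp add: prod.distrib power_sum prod_g)
  also have "\<dots> \<le> S ^ n * unmatched_ratio k ^ n"
    using S sum_U unmatched_ratio_ge_1[OF k] by (intro mult_left_mono power_increasing) auto
  also have "\<dots> = ((c k)\<^sup>2) ^ n"
    using c_squared[OF k] by (simp add: S_def power_mult_distrib)
  also have "\<dots> = (c k ^ n)\<^sup>2"
    by (simp add: mult.commute flip: power_mult)
  finally show ?thesis .
qed

theorem theorem7p1:
  fixes k n :: nat
  assumes "k \<ge> 2" and "n \<ge> k"
  shows "M_T n k \<le> c k ^ n"
proof -
  have "det A \<le> c k ^ n" if "A \<in> T n k" for A
    using det_sq_le_c_of_T[OF assms(1) that] by (rule power2_le_imp_le) (simp add: c_def)
  then show ?thesis
    unfolding M_T_def using finite_T[of n k] T_nonempty[OF assms(2)] by auto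
qed

end
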